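(* There is a universal constant $c>0$ such that the following holds for all $\delta\in(0,1)$, all positive integers $N,n,d$ with $N\ge n\ge c$ and $d\ge c\log\frac{n}{\delta}$, and all $\gamma\in[0,\frac1{25}]$. Let $\mathcal M$ be the mechanism that on input a dataset $S\in(\{0,1\}^d)^n$ returns the exact average $\mathrm{Average}(S)\in[0,1]^d$ of the rows of $S$. Then for every $\varepsilon\ge 0$, $\mathcal M$ is $(\varepsilon,\delta,\mathrm{Tardos}(N,d,n),R^H_\gamma)$-Bayesian extraction-safe.
   Context: Bayesian extraction-safety. Let $\mathcal X$ be a data domain and let $\mathrm{Prior}$ be a meta-distribution, i.e. a distribution over distributions over datasets containing elements of $\mathcal X$. Let $R:\mathcal X^*\times\{0,1\}^*\to\{0,1\}$ be a relation. A (possibly randomized) algorithm $\mathcal M$ is $(\varepsilon,\delta,\mathrm{Prior},R)$-Bayesian extraction-safe if for every (possibly randomized, computationally unbounded) attacker $\mathcal A$, $$\Pr[R(S,z)=1]\le e^{\varepsilon}\cdot\Pr[R(T,z)=1]+\delta,$$ where in both probabilities $\mathrm{Nature}\leftarrow\mathrm{Prior}$, $S\leftarrow\mathrm{Nature}$, $y\leftarrow\mathcal M(S)$, $z\leftarrow\mathcal A(y)$, and on the right-hand side $T\leftarrow\mathrm{Nature}$ is a second dataset drawn independently of $S$ given $\mathrm{Nature}$. Tardos prior. For integers $N\ge n$ and $d$, $\mathrm{Tardos}(N,d,n)$ is the meta-distribution over distributions on datasets of $n$ elements of $\mathcal X=\{0,1\}^d$ sampled as follows: (1) sample $p_1,\dots,p_d\in[0,1]$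 uniformly and independently; (2) generate a matrix $C\in\{0,1\}^{N\times d}$ whose entries $C[i,j]$ are sampled independently from $\mathrm{Ber}(p_j)$; (3) return the distribution of a sample of $n$ rows of $C$ drawn uniformly without repetitions (i.e. $n$ distinct row indices of $C$). Hamming relation. For $\gamma\ge 0$, a dataset $S\in(\{0,1\}^d)^n$ and $z\in\{0,1\}^d$, $R^H_\gamma(S,z)=1$ iff there is $x\in S$ whose Hamming distance to $z$ is at most $\gamma d$. *)

theory Defs
  imports "HOL-Probability.Probability"
begin

section \<open>Bayesian extraction safety\<close>

text \<open>
  \<open>D\<close> is the measurable space of datasets and \<open>Y\<close> that of the mechanism's outputs.  A randomized
  algorithm is a Markov kernel, i.e. a measurable function into \<open>prob_algebra\<close>; a meta-distribution
  is a probability measure on the space \<open>prob_algebra D\<close> of distributions over datasets.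
  Attackers output bit strings of arbitrary length.
\<close>

type_synonym 'x dataset = "'x list"

definition extraction_game ::
  "'x dataset measure measure \<Rightarrow> ('x dataset \<Rightarrow> bool list \<Rightarrow> bool) \<Rightarrow> ('x dataset \<Rightarrow> 'y measure) \<Rightarrow>
   ('y \<Rightarrow> bool list measure) \<Rightarrow> bool measure" where
  "extraction_game Prior R M A = do {
     Nature \<leftarrow> Prior;
     S \<leftarrow> Nature;
     y \<leftarrow> M S;
     z \<leftarrow> A y;
     return (count_space UNIV) (R S z)
   }"

definition fresh_extraction_game ::
  "'x dataset measure measure \<Rightarrow> ('x dataset \<Rightarrow> bool list \<Rightarrow> bool) \<Rightarrow> ('x dataset \<Rightarrow> 'y measure) \<Rightarrow>
   ('y \<Rightarrow> bool list measure) \<Rightarrow> bool measure" where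
  "fresh_extraction_game Prior R M A = do {
     Nature \<leftarrow> Prior;
     S \<leftarrow> Nature;
     T \<leftarrow> Nature;
     y \<leftarrow> M S;
     z \<leftarrow> A y;
     return (count_space UNIV) (R T z)
   }"

text \<open>
  The first three conjuncts say that the prior, the mechanism and the relation are of the right
  kind; without them the Giry-monad binds in the two games would not be meaningful.
\<close>

definition bayesian_extraction_safe ::
  "'x dataset measure \<Rightarrow> 'y measure \<Rightarrow> real \<Rightarrow> real \<Rightarrow> 'x dataset measure measure \<Rightarrow>
   ('x dataset \<Rightarrow> bool list \<Rightarrow> bool) \<Rightarrow> ('x dataset \<Rightarrow> 'y measure) \<Rightarrow> bool" where
  "bayesian_extraction_safe D Y \<epsilon> \<delta> Prior R M \<longleftrightarrow>
     Prior \<in> space (prob_algebra (prob_algebra D)) \<and>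
     M \<in> D \<rightarrow>\<^sub>M prob_algebra Y \<and>
     Measurable.pred (D \<Otimes>\<^sub>M count_space UNIV) (\<lambda>(S, z). R S z) \<and>
     (\<forall>A \<in> Y \<rightarrow>\<^sub>M prob_algebra (count_space UNIV).
        measure (extraction_game Prior R M A) {True}
          \<le> exp \<epsilon> * measure (fresh_extraction_game Prior R M A) {True} + \<delta>)"


section \<open>The Tardos prior\<close>

text \<open>
  The points of \<open>{0,1}\<^sup>d\<close> are the bit strings of length \<open>d\<close>, and \<open>C (i, j)\<close> is the entry of the
  matrix in row \<open>i\<close> and column \<open>j\<close>, with indices starting at \<open>0\<close>.  Two distinct row indices may
  carry equal rows, so a sampled dataset can contain the same point several times.
\<close>

definition matrix_row :: "nat \<Rightarrow> (nat \<times> nat \<Rightarrow> bool) \<Rightarrow> nat \<Rightarrow> bool list" where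
  "matrix_row d C i = map (\<lambda>j. C (i, j)) [0..<d]"

definition sample_rows_pmf ::
  "nat \<Rightarrow> nat \<Rightarrow> nat \<Rightarrow> (nat \<times> nat \<Rightarrow> bool) \<Rightarrow> bool list dataset pmf" where
  "sample_rows_pmf N d n C =
     map_pmf (map (matrix_row d C)) (pmf_of_set {is. length is = n \<and> distinct is \<and> set is \<subseteq> {..<N}})"

definition tardos_matrix_pmf :: "nat \<Rightarrow> nat \<Rightarrow> (nat \<Rightarrow> real) \<Rightarrow> (nat \<times> nat \<Rightarrow> bool) pmf" where
  "tardos_matrix_pmf N d p = Pi_pmf ({..<N} \<times> {..<d}) False (\<lambda>(i, j). bernoulli_pmf (p j))"

definition tardos :: "nat \<Rightarrow> nat \<Rightarrow> nat \<Rightarrow> bool list dataset measure measure" where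
  "tardos N d n = do {
     p \<leftarrow> (\<Pi>\<^sub>M j\<in>{..<d}. uniform_measure lborel {0..1});
     C \<leftarrow> measure_pmf (tardos_matrix_pmf N d p);
     return (prob_algebra (count_space UNIV)) (measure_pmf (sample_rows_pmf N d n C))
   }"


section \<open>Hamming relation and exact average\<close>

definition hamming_dist :: "bool list \<Rightarrow> bool list \<Rightarrow> nat" where
  "hamming_dist x z = card {j. j < length z \<and> x ! j \<noteq> z ! j}"

text \<open>An attacker's output of length other than \<open>d\<close> never counts as a successful extraction.\<close>

definition hamming_relation :: "nat \<Rightarrow> real \<Rightarrow> bool list dataset \<Rightarrow> bool list \<Rightarrow> bool" where
  "hamming_relation d \<gamma> S z \<longleftrightarrow>
     length z = d \<and> (\<exists>x\<in>set S. length x = d \<and> real (hamming_dist x z) \<le> \<gamma> * real d)"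

definition average :: "nat \<Rightarrow> bool list dataset \<Rightarrow> real list" where
  "average d S = map (\<lambda>j. (\<Sum>x\<leftarrow>S. of_bool (x ! j)) / real (length S)) [0..<d]"

text \<open>
  The output space carries the discrete sigma-algebra, so that the attackers against this mechanism
  are all randomized functions of its output, not only the Borel measurable ones.
\<close>

definition average_mechanism :: "nat \<Rightarrow> bool list dataset \<Rightarrow> real list measure" where
  "average_mechanism d S = return (count_space UNIV) (average d S)"


section \<open>Well-definedness of the prior\<close>

context
begin

interpretation pmf_as_function .

lemma pmf_bernoulli_clamp:
  "pmf (bernoulli_pmf q) b = (if b then min 1 (max 0 q) else 1 - min 1 (max 0 q))"
  by transfer simp

end

lemma measurable_pmf_bernoulli: "(\<lambda>q. pmf (bernoulli_pmf q) b) \<in> borel_measurable borel"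
  unfolding pmf_bernoulli_clamp by (cases b) simp_all

lemma measurable_tardos_matrix_pmf:
  "(\<lambda>p. measure_pmf (tardos_matrix_pmf N d p))
     \<in> (\<Pi>\<^sub>M j\<in>{..<d}. uniform_measure lborel {0..1}) \<rightarrow>\<^sub>M prob_algebra (count_space UNIV)"
    (is "_ \<in> ?P \<rightarrow>\<^sub>M _")
proof (rule measurable_prob_algebraI)
  show "(\<lambda>p. measure_pmf (tardos_matrix_pmf N d p)) \<in> ?P \<rightarrow>\<^sub>M subprob_algebra (count_space UNIV)"
  proof (rule measurable_subprob_algebra)
    fix X :: "(nat \<times> nat \<Rightarrow> bool) set"
    define F where "F = PiE_dflt ({..<N} \<times> {..<d}) False (\<lambda>_. UNIV :: bool set)"
    have fin: "finite F"
      unfolding F_def by (intro finite_PiE_dflt) auto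
    have meas: "(\<lambda>p. pmf (tardos_matrix_pmf N d p) C) \<in> borel_measurable ?P" for C
    proof -
      have "(\<lambda>p. pmf (bernoulli_pmf (p j)) b) \<in> borel_measurable ?P" if "j < d" for j b
      proof (rule measurable_compose[OF _ measurable_pmf_bernoulli])
        have "(\<lambda>p. p j) \<in> ?P \<rightarrow>\<^sub>M uniform_measure lborel {0..1}"
          using that by (intro measurable_component_singleton) auto
        then show "(\<lambda>p. p j) \<in> ?P \<rightarrow>\<^sub>M borel"
          by (simp cong: measurable_cong_sets)
      qed
      then show ?thesis
        unfolding tardos_matrix_pmf_def
        by (subst pmf_Pi, simp, cases "\<forall>x. x \<notin> {..<N} \<times> {..<d} \<longrightarrow> C x = False")
          (simp_all only: if_True if_False,
            auto intro!: borel_measurable_prod simp: case_prod_beta)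
    qed
    have "emeasure (measure_pmf (tardos_matrix_pmf N d p)) X =
        (\<Sum>C\<in>F \<inter> X. ennreal (pmf (tardos_matrix_pmf N d p) C))" for p
    proof -
      have sub: "set_pmf (tardos_matrix_pmf N d p) \<subseteq> F"
        unfolding tardos_matrix_pmf_def F_def
        using set_Pi_pmf_subset'[of "{..<N} \<times> {..<d}" False "\<lambda>(i, j). bernoulli_pmf (p j)"]
        by (auto simp: PiE_dflt_def)
      have "emeasure (measure_pmf (tardos_matrix_pmf N d p)) X =
          emeasure (measure_pmf (tardos_matrix_pmf N d p)) (F \<inter> X)"
        by (rule emeasure_eq_AE) (use sub in \<open>auto simp: AE_measure_pmf_iff\<close>)
      also have "\<dots> = (\<Sum>C\<in>F \<inter> X. ennreal (pmf (tardos_matrix_pmf N d p) C))"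
        using fin by (simp add: emeasure_measure_pmf_finite sum_ennreal)
      finally show ?thesis .
    qed
    then show "(\<lambda>p. emeasure (measure_pmf (tardos_matrix_pmf N d p)) X) \<in> borel_measurable ?P"
      by (simp only:) (intro borel_measurable_sum measurable_compose[OF meas measurable_ennreal])
  next
    fix p
    show "subprob_space (measure_pmf (tardos_matrix_pmf N d p))"
      by (rule prob_space_imp_subprob_space) (rule prob_space_measure_pmf)
  qed simp
qed (rule prob_space_measure_pmf)

lemma tardos_in_space: "tardos N d n \<in> space (prob_algebra (prob_algebra (count_space UNIV)))"
proof -
  let ?P = "\<Pi>\<^sub>M j\<in>{..<d}. uniform_measure lborel {0..1::real}"
  have "prob_space (uniform_measure lborel {0..1::real})"
    by (intro prob_space_uniform_measure) auto
  then have P: "?P \<in> space (prob_algebra ?P)"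
    by (auto simp: space_prob_algebra intro!: prob_space_PiM)
  have row: "(\<lambda>C. return (prob_algebra (count_space UNIV)) (measure_pmf (sample_rows_pmf N d n C)))
      \<in> count_space UNIV \<rightarrow>\<^sub>M prob_algebra (prob_algebra (count_space UNIV))"
    by (auto simp: space_prob_algebra prob_space_measure_pmf intro!: prob_space_return)
  have "(\<lambda>p. measure_pmf (tardos_matrix_pmf N d p) \<bind> (\<lambda>C.
        return (prob_algebra (count_space UNIV)) (measure_pmf (sample_rows_pmf N d n C))))
      \<in> ?P \<rightarrow>\<^sub>M prob_algebra (prob_algebra (count_space UNIV))"
    by (rule measurable_bind_prob_space[OF measurable_tardos_matrix_pmf row])
  from measurable_bind_prob_space[OF measurable_const[OF P] this]
  have "(\<lambda>_. tardos N d n) \<in> count_space (UNIV :: unit set) \<rightarrow>\<^sub>M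
      prob_algebra (prob_algebra (count_space UNIV))"
    unfolding tardos_def .
  then show ?thesis
    by (rule measurable_space[of _ _ _ "()"]) simp
qed

end

theory Submission
  imports Defs
begin

text \<open>
  The bound already holds without the fresh-sample term.  Fix \<open>p\<close>, the sampled row indices and one
  sampled row \<open>x\<close>.  By exchangeability, given the column sums \<open>k\<^sub>j\<close> the bits of \<open>x\<close> are independent with
  law \<open>Ber(k\<^sub>j / n)\<close>, so whatever \<open>z\<close> the attacker computes from the average, bit \<open>j\<close> of \<open>z\<close> is wrong with
  probability at least \<open>(k\<^sub>j / n) (1 - k\<^sub>j / n)\<close>.  Averaging \<open>2\<^sup>-\<^sup>h\<close>, where \<open>h\<close> is the Hamming distance of \<open>x\<close>
  and \<open>z\<close>, over the columns gives a factor \<open>1 - p\<^sub>j (1 - p\<^sub>j) (1 - 1/n) / 2\<close> per column, and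
  over \<open>p\<^sub>j\<close> a factor \<open>1 - (1 - 1/n) / 12\<close>.  A Chernoff bound and a union bound over the \<open>n\<close> sampled rows
  finish the proof.
\<close>

section \<open>Guessing from statistics of independent columns\<close>

text \<open>
  \<open>a\<close> is the attacker, who sees only the statistics \<open>s (C j)\<close> of the independent columns \<open>C j\<close>; \<open>v k\<close> bounds
  the conditional expectation of \<open>u z j\<close> on the fibre \<open>s = k\<close>, uniformly in the guess \<open>z\<close>.
\<close>

lemma sum_PiE_fibre_bound:
  fixes w :: "'j \<Rightarrow> 'c \<Rightarrow> real" and u :: "'z \<Rightarrow> 'j \<Rightarrow> 'c \<Rightarrow> real" and s :: "'c \<Rightarrow> 'k"
    and v :: "'k \<Rightarrow> real" and a :: "('j \<Rightarrow> 'k) \<Rightarrow> 'z \<Rightarrow> real"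
  assumes fin: "finite J" "finite \<Omega>"
    and nonneg: "\<And>j c. 0 \<le> w j c" "\<And>z j c. 0 \<le> u z j c" "\<And>k z. 0 \<le> a k z"
      "\<And>k. k \<in> s ` \<Omega> \<Longrightarrow> 0 \<le> v k"
    and mass: "\<And>k. sum (a k) Z \<le> 1"
    and fibre: "\<And>z j k. j \<in> J \<Longrightarrow> z \<in> Z \<Longrightarrow>
      (\<Sum>c | c \<in> \<Omega> \<and> s c = k. w j c * u z j c) \<le> v k * (\<Sum>c | c \<in> \<Omega> \<and> s c = k. w j c)"
  shows "(\<Sum>C\<in>J \<rightarrow>\<^sub>E \<Omega>. (\<Prod>j\<in>J. w j (C j)) *
      (\<Sum>z\<in>Z. a (\<lambda>j\<in>J. s (C j)) z * (\<Prod>j\<in>J. u z j (C j))))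
    \<le> (\<Prod>j\<in>J. \<Sum>c\<in>\<Omega>. w j c * v (s c))"
proof -
  define K where "K = J \<rightarrow>\<^sub>E s ` \<Omega>"
  define \<Phi> where "\<Phi> k = {c. c \<in> \<Omega> \<and> s c = k}" for k
  \<comment> \<open>Prescribing the statistic of every column cuts out a product of fibres. Once
    \<open>k\<close> and \<open>z\<close> are frozen, \<open>a k z\<close> is a constant and the
    remaining sum factors over the columns.\<close>
  have fib: "{C \<in> J \<rightarrow>\<^sub>E \<Omega>. (\<lambda>j\<in>J. s (C j)) = k} = (\<Pi>\<^sub>E j\<in>J. \<Phi> (k j))" if "k \<in> K" for k
  proof (intro set_eqI iffI)
    fix C assume "C \<in> {C \<in> J \<rightarrow>\<^sub>E \<Omega>. (\<lambda>j\<in>J. s (C j)) = k}"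
    then show "C \<in> (\<Pi>\<^sub>E j\<in>J. \<Phi> (k j))" by (auto simp: \<Phi>_def PiE_iff)
  next
    fix C assume C: "C \<in> (\<Pi>\<^sub>E j\<in>J. \<Phi> (k j))"
    have "(\<lambda>j\<in>J. s (C j)) = k"
      using C that by (intro extensionalityI[of _ J]) (auto simp: \<Phi>_def K_def PiE_iff)
    with C show "C \<in> {C \<in> J \<rightarrow>\<^sub>E \<Omega>. (\<lambda>j\<in>J. s (C j)) = k}" by (auto simp: \<Phi>_def PiE_iff)
  qed
  have "(\<Sum>C\<in>J \<rightarrow>\<^sub>E \<Omega>. (\<Prod>j\<in>J. w j (C j)) *
        (\<Sum>z\<in>Z. a (\<lambda>j\<in>J. s (C j)) z * (\<Prod>j\<in>J. u z j (C j))))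
      = (\<Sum>k\<in>K. \<Sum>C | C \<in> J \<rightarrow>\<^sub>E \<Omega> \<and> (\<lambda>j\<in>J. s (C j)) = k. (\<Prod>j\<in>J. w j (C j)) *
        (\<Sum>z\<in>Z. a (\<lambda>j\<in>J. s (C j)) z * (\<Prod>j\<in>J. u z j (C j))))"
    by (rule sum.group[symmetric]) (use fin in \<open>auto simp: K_def intro!: finite_PiE\<close>)
  also have "\<dots> = (\<Sum>k\<in>K. \<Sum>C\<in>(\<Pi>\<^sub>E j\<in>J. \<Phi> (k j)). (\<Prod>j\<in>J. w j (C j)) *
        (\<Sum>z\<in>Z. a k z * (\<Prod>j\<in>J. u z j (C j))))"
  proof (intro sum.cong[OF refl])
    fix k assume k: "k \<in> K"
    show "(\<Sum>C | C \<in> J \<rightarrow>\<^sub>E \<Omega> \<and> (\<lambda>j\<in>J. s (C j)) = k. (\<Prod>j\<in>J. w j (C j)) *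
        (\<Sum>z\<in>Z. a (\<lambda>j\<in>J. s (C j)) z * (\<Prod>j\<in>J. u z j (C j))))
      = (\<Sum>C\<in>(\<Pi>\<^sub>E j\<in>J. \<Phi> (k j)). (\<Prod>j\<in>J. w j (C j)) *
        (\<Sum>z\<in>Z. a k z * (\<Prod>j\<in>J. u z j (C j))))"
      unfolding fib[OF k, symmetric] by (intro sum.cong) auto
  qed
  also have "\<dots> = (\<Sum>k\<in>K. \<Sum>z\<in>Z. a k z * (\<Sum>C\<in>(\<Pi>\<^sub>E j\<in>J. \<Phi> (k j)). (\<Prod>j\<in>J. w j (C j) * u z j (C j))))"
    by (intro sum.cong[OF refl], unfold sum_distrib_left, subst sum.swap)
       (simp add: prod.distrib mult_ac)
  also have "\<dots> = (\<Sum>k\<in>K. \<Sum>z\<in>Z. a k z * (\<Prod>j\<in>J. \<Sum>c\<in>\<Phi> (k j). w j c * u z j c))"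
    using fin by (subst prod_sum_PiE) (auto simp: \<Phi>_def)
  also have "\<dots> \<le> (\<Sum>k\<in>K. \<Sum>z\<in>Z. a k z * (\<Prod>j\<in>J. v (k j) * (\<Sum>c\<in>\<Phi> (k j). w j c)))"
    using fibre nonneg unfolding \<Phi>_def
    by (intro sum_mono mult_left_mono prod_mono) (auto intro!: sum_nonneg)
  also have "\<dots> = (\<Sum>k\<in>K. sum (a k) Z * (\<Prod>j\<in>J. v (k j) * (\<Sum>c\<in>\<Phi> (k j). w j c)))"
    by (simp add: sum_distrib_right)
  \<comment> \<open>The product no longer depends on \<open>z\<close>, so randomising the guess
    gains nothing over total mass 1.\<close>
  also have "\<dots> \<le> (\<Sum>k\<in>K. 1 * (\<Prod>j\<in>J. v (k j) * (\<Sum>c\<in>\<Phi> (k j). w j c)))"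
    using mass nonneg(1) nonneg(4)[OF PiE_mem[of _ J "\<lambda>_. s ` \<Omega>"]] unfolding K_def
    by (intro sum_mono mult_right_mono prod_nonneg ballI mult_nonneg_nonneg sum_nonneg) auto
  also have "\<dots> = (\<Prod>j\<in>J. \<Sum>k\<in>s ` \<Omega>. v k * (\<Sum>c\<in>\<Phi> k. w j c))"
    unfolding K_def using fin by (subst prod_sum_PiE) auto
  also have "\<dots> = (\<Prod>j\<in>J. \<Sum>k\<in>s ` \<Omega>. \<Sum>c | c \<in> \<Omega> \<and> s c = k. w j c * v (s c))"
    by (intro prod.cong sum.cong refl) (simp add: \<Phi>_def sum_distrib_left mult_ac)
  also have "\<dots> = (\<Prod>j\<in>J. \<Sum>c\<in>\<Omega>. w j c * v (s c))"
    using fin by (intro prod.cong refl sum.group) auto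
  finally show ?thesis .
qed

section \<open>A single column: exchangeability and second moments\<close>

lemma sum_PiE_transpose:
  fixes f :: "('i \<Rightarrow> 'b) \<Rightarrow> real"
  assumes "r \<in> R" "t \<in> R"
  shows "(\<Sum>c\<in>R \<rightarrow>\<^sub>E B. f (c \<circ> Transposition.transpose r t)) = (\<Sum>c\<in>R \<rightarrow>\<^sub>E B. f c)"
  by (rule sum.reindex_bij_witness[where i = "\<lambda>c. c \<circ> Transposition.transpose r t"
        and j = "\<lambda>c. c \<circ> Transposition.transpose r t"])
     (use assms in \<open>auto simp: PiE_iff extensional_def Transposition.transpose_def fun_eq_iff\<close>)

text \<open>Exchanging two rows of \<open>I\<close> preserves both the product weight and the column
  sum, so on a fibre all rows of \<open>I\<close> carry the same weighted share of ones. These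
  \<open>card I\<close> shares add up to \<open>k\<close> times the weight of the fibre. On a fibre
  of positive weight this is the conditional law \<open>Ber(k / card I)\<close> of the bit in row
  \<open>r\<close>.\<close>

lemma fibre_share:
  fixes g :: "bool \<Rightarrow> real"
  assumes "finite R" "I \<subseteq> R" "r \<in> I"
  defines "\<Omega> \<equiv> R \<rightarrow>\<^sub>E UNIV" and "s \<equiv> \<lambda>c. card {i\<in>I. c i}"
  shows "real (card I) * (\<Sum>c | c \<in> \<Omega> \<and> s c = k. (\<Prod>i\<in>R. g (c i)) * of_bool (c r))
    = real k * (\<Sum>c | c \<in> \<Omega> \<and> s c = k. \<Prod>i\<in>R. g (c i))"
proof -
  have fin: "finite \<Omega>" "finite I"
    using assms finite_subset by (auto intro!: finite_PiE)
  define h where "h t c = of_bool (s c = k) * (\<Prod>i\<in>R. g (c i)) * of_bool (c t)" for t c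
  have restr: "(\<Sum>c | c \<in> \<Omega> \<and> s c = k. f c) = (\<Sum>c\<in>\<Omega>. of_bool (s c = k) * f c)"
    for f :: "_ \<Rightarrow> real"
    using fin by (intro sum.mono_neutral_cong_left) auto
  have "(\<Sum>c\<in>\<Omega>. h t c) = (\<Sum>c\<in>\<Omega>. h r c)" if t: "t \<in> I" for t
  proof -
    let ?\<tau> = "Transposition.transpose r t"
    \<comment> \<open>Both swapped rows lie in \<open>I\<close>, so the swap maps \<open>I\<close>
      and \<open>R\<close> onto themselves: the first fact preserves the column sum, the second the
      weight.\<close>
    have bij: "bij_betw ?\<tau> I I" "bij_betw ?\<tau> R R"
      using t assms by (auto intro!: bij_betw_byWitness[where f' = ?\<tau>] simp: Transposition.transpose_def)
    have "h r (c \<circ> ?\<tau>) = h t c" for c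
    proof -
      have "bij_betw ?\<tau> {i\<in>I. c (?\<tau> i)} {i\<in>I. c i}"
        using bij(1) by (intro bij_betw_byWitness[where f' = ?\<tau>]) (auto dest: bij_betwE)
      then have "s (c \<circ> ?\<tau>) = s c"
        unfolding s_def by (auto dest: bij_betw_same_card)
      moreover have "(\<Prod>i\<in>R. g (c (?\<tau> i))) = (\<Prod>i\<in>R. g (c i))"
        by (rule prod.reindex_bij_betw[OF bij(2)])
      ultimately show ?thesis by (simp add: h_def)
    qed
    then have "(\<Sum>c\<in>\<Omega>. h t c) = (\<Sum>c\<in>\<Omega>. h r (c \<circ> ?\<tau>))" by simp
    also have "\<dots> = (\<Sum>c\<in>\<Omega>. h r c)"
      unfolding \<Omega>_def using t assms by (intro sum_PiE_transpose) auto
    finally show ?thesis .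
  qed
  then have "real (card I) * (\<Sum>c\<in>\<Omega>. h r c) = (\<Sum>t\<in>I. \<Sum>c\<in>\<Omega>. h t c)"
    by simp
  also have "\<dots> = (\<Sum>c\<in>\<Omega>. \<Sum>t\<in>I. h t c)"
    by (rule sum.swap)
  also have "\<dots> = (\<Sum>c\<in>\<Omega>. real k * (of_bool (s c = k) * (\<Prod>i\<in>R. g (c i))))"
  proof (intro sum.cong refl)
    fix c
    have "(\<Sum>t\<in>I. of_bool (c t)) = real (s c)"
      using fin by (simp add: s_def Int_def)
    then have "(\<Sum>t\<in>I. h t c) = of_bool (s c = k) * (\<Prod>i\<in>R. g (c i)) * real (s c)"
      by (simp only: h_def sum_distrib_left[symmetric])
    then show "(\<Sum>t\<in>I. h t c) = real k * (of_bool (s c = k) * (\<Prod>i\<in>R. g (c i)))"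
      by simp
  qed
  finally show ?thesis
    unfolding restr h_def by (simp add: sum_distrib_left mult_ac)
qed

text \<open>
  The best guess for the bit \<open>c r\<close> errs with probability \<open>min x (1 - x)\<close>.  The weaker bound \<open>x (1 - x)\<close>
  is used because its expectation only involves second moments.
\<close>

lemma fibre_guess_bound:
  fixes g :: "bool \<Rightarrow> real" and k :: nat
  assumes "finite R" "I \<subseteq> R" "r \<in> I" "\<And>b. 0 \<le> g b"
  defines "\<Omega> \<equiv> R \<rightarrow>\<^sub>E UNIV" and "s \<equiv> \<lambda>c. card {i\<in>I. c i}"
    and "x \<equiv> real k / real (card I)"
  shows "(\<Sum>c | c \<in> \<Omega> \<and> s c = k. (\<Prod>i\<in>R. g (c i)) * (if c r = b then 1 else 1 / 2))
    \<le> (1 - x * (1 - x) / 2) * (\<Sum>c | c \<in> \<Omega> \<and> s c = k. \<Prod>i\<in>R. g (c i))"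
proof (cases "\<exists>c. c \<in> \<Omega> \<and> s c = k")
  case True
  define W where "W = (\<Sum>c | c \<in> \<Omega> \<and> s c = k. \<Prod>i\<in>R. g (c i))"
  define V where "V = (\<Sum>c | c \<in> \<Omega> \<and> s c = k. (\<Prod>i\<in>R. g (c i)) * of_bool (c r))"
  have finI: "finite I" using assms finite_subset by auto
  then have cI: "card I > 0" using assms card_gt_0_iff by blast
  have "k \<le> card I" using True finI by (auto simp: s_def intro!: card_mono)
  then have x: "0 \<le> x" "x \<le> 1" using cI by (auto simp: x_def)
  have W: "W \<ge> 0" unfolding W_def using assms by (intro sum_nonneg prod_nonneg) auto
  have V: "V = x * W"
    using fibre_share[OF assms(1-3), where k = k and g = g] cI
    unfolding V_def W_def \<Omega>_def s_def x_def by (simp add: field_simps)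
  \<comment> \<open>The score is affine in the indicator of \<open>c r\<close>, with slope
    \<open>1/2\<close> or \<open>-1/2\<close> according to the guess \<open>b\<close>. Hence only
    the total weight \<open>W\<close> and the share \<open>V\<close> of ones enter.\<close>
  have "(\<Sum>c | c \<in> \<Omega> \<and> s c = k. (\<Prod>i\<in>R. g (c i)) * (if c r = b then 1 else 1 / 2))
      = (\<Sum>c | c \<in> \<Omega> \<and> s c = k. (if b then 1 / 2 else 1) * (\<Prod>i\<in>R. g (c i)) +
          (if b then 1 / 2 else - 1 / 2) * ((\<Prod>i\<in>R. g (c i)) * of_bool (c r)))"
    by (intro sum.cong refl) auto
  also have "\<dots> = (if b then 1 / 2 else 1) * W + (if b then 1 / 2 else - 1 / 2) * V"
    unfolding W_def V_def sum.distrib sum_distrib_left ..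
  also have "\<dots> = (1 - (if b then 1 - x else x) / 2) * W"
    by (auto simp: V field_simps)
  also have "\<dots> \<le> (1 - x * (1 - x) / 2) * W"
  proof (intro mult_right_mono W)
    have "x * (1 - x) \<le> x" "x * (1 - x) \<le> 1 - x"
      using x by (simp_all add: mult_left_le mult_right_le_one_le mult_left_le_one_le)
    then show "1 - (if b then 1 - x else x) / 2 \<le> 1 - x * (1 - x) / 2" by auto
  qed
  finally show ?thesis unfolding W_def .
next
  \<comment> \<open>The empty fibre is separate because \<open>x \<le> 1\<close> was obtained from a
    column in the fibre; here both sums vanish.\<close>
  case False
  then have "{c. c \<in> \<Omega> \<and> s c = k} = {}" by auto
  then show ?thesis by (simp only: sum.empty)
qed

text \<open>With \<open>n = card I\<close>, the product of the numbers of ones and zeros in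
  \<open>I\<close> counts ordered pairs of a row holding a one and a row holding a zero. By
  independence each of the \<open>n * (n - 1)\<close> pairs of distinct rows has weight
  \<open>g True * g False\<close>, and a row paired with itself contributes nothing. Dividing by
  \<open>n^2\<close> leaves the factor \<open>1 - 1/n\<close>.\<close>

lemma column_expectation:
  fixes g :: "bool \<Rightarrow> real"
  assumes "finite R" "I \<subseteq> R" "I \<noteq> {}" and g: "g True + g False = 1"
  defines "s \<equiv> \<lambda>c. card {i\<in>I. c i}"
  shows "(\<Sum>c\<in>R \<rightarrow>\<^sub>E UNIV. (\<Prod>i\<in>R. g (c i)) *
      (1 - real (s c) / real (card I) * (1 - real (s c) / real (card I)) / 2))
    = 1 - g True * g False * (1 - 1 / real (card I)) / 2"
proof -
  let ?\<Omega> = "R \<rightarrow>\<^sub>E (UNIV :: bool set)"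
  define n where "n = real (card I)"
  have finI: "finite I" using assms finite_subset by auto
  then have n: "n > 0" using assms by (simp add: n_def card_gt_0_iff)
  have prodsum: "(\<Sum>c\<in>?\<Omega>. \<Prod>i\<in>R. f i (c i)) = (\<Prod>i\<in>R. f i True + f i False)"
    for f :: "'a \<Rightarrow> bool \<Rightarrow> real"
    using assms(1) by (subst prod_sum_PiE[symmetric]) (auto simp: UNIV_bool add.commute)
  have total: "(\<Sum>c\<in>?\<Omega>. \<Prod>i\<in>R. g (c i)) = 1"
    using prodsum[of "\<lambda>_. g"] g by simp
  have pair: "(\<Sum>c\<in>?\<Omega>. (\<Prod>i\<in>R. g (c i)) * (of_bool (c i) * of_bool (\<not> c j)))
      = of_bool (i \<noteq> j) * (g True * g False)" if ij: "i \<in> I" "j \<in> I" for i j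
  proof (cases "i = j")
    case False
    \<comment> \<open>The two constraints are distributed over the row factors, so that the sum over
      columns becomes a product over rows in which every row other than \<open>i\<close> and
      \<open>j\<close> contributes \<open>g True + g False = 1\<close>.\<close>
    define f where "f l b = g b * (if l = i then of_bool b else 1) * (if l = j then of_bool (\<not> b) else 1)" for l b
    have "(\<Sum>c\<in>?\<Omega>. (\<Prod>i\<in>R. g (c i)) * (of_bool (c i) * of_bool (\<not> c j))) = (\<Sum>c\<in>?\<Omega>. \<Prod>l\<in>R. f l (c l))"
    proof (intro sum.cong refl)
      fix c
      have "(\<Prod>l\<in>R. if l = i then of_bool (c l) else 1 :: real) = of_bool (c i)"
           "(\<Prod>l\<in>R. if l = j then of_bool (\<not> c l) else 1 :: real) = of_bool (\<not> c j)"
        using assms(1,2) ij by (auto simp: prod.delta)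
      then show "(\<Prod>i\<in>R. g (c i)) * (of_bool (c i) * of_bool (\<not> c j)) = (\<Prod>l\<in>R. f l (c l))"
        by (simp add: f_def prod.distrib)
    qed
    also have "\<dots> = (\<Prod>l\<in>R. (if l = i then g True else 1) * (if l = j then g False else 1))"
      unfolding prodsum using False g by (intro prod.cong) (auto simp: f_def)
    also have "\<dots> = g True * g False"
      unfolding prod.distrib using assms(1,2) ij by (auto simp: prod.delta)
    finally show ?thesis using False by simp
  next
    case True
    have "(\<Prod>i\<in>R. g (c i)) * (of_bool (c i) * of_bool (\<not> c j)) = 0" for c
      using True by simp
    then show ?thesis using True by (simp only: sum.neutral_const) simp
  qed
  have "(\<Sum>c\<in>?\<Omega>. (\<Prod>i\<in>R. g (c i)) * (real (s c) * (n - real (s c))))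
      = (\<Sum>c\<in>?\<Omega>. \<Sum>i\<in>I. \<Sum>j\<in>I. (\<Prod>i\<in>R. g (c i)) * (of_bool (c i) * of_bool (\<not> c j)))"
  proof (intro sum.cong refl)
    fix c
    have 1: "real (s c) = (\<Sum>i\<in>I. of_bool (c i))"
      using finI by (simp add: s_def Int_def)
    have 2: "n - real (s c) = (\<Sum>i\<in>I. of_bool (\<not> c i))"
      unfolding 1 n_def by (simp add: of_bool_not_iff sum_subtractf del: sum_of_bool_eq)
    show "(\<Prod>i\<in>R. g (c i)) * (real (s c) * (n - real (s c)))
      = (\<Sum>i\<in>I. \<Sum>j\<in>I. (\<Prod>i\<in>R. g (c i)) * (of_bool (c i) * of_bool (\<not> c j)))"
      by (subst 2, subst 1, subst sum_product) (simp only: sum_distrib_left)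
  qed
  also have "\<dots> = (\<Sum>i\<in>I. \<Sum>j\<in>I. \<Sum>c\<in>?\<Omega>. (\<Prod>i\<in>R. g (c i)) * (of_bool (c i) * of_bool (\<not> c j)))"
    by (subst sum.swap, intro sum.cong refl, rule sum.swap)
  also have "\<dots> = (\<Sum>i\<in>I. \<Sum>j\<in>I. of_bool (i \<noteq> j) * (g True * g False))"
    by (intro sum.cong refl pair)
  also have "\<dots> = (\<Sum>i\<in>I. (n - 1) * (g True * g False))"
  proof (intro sum.cong refl)
    fix i assume i: "i \<in> I"
    have "(\<Sum>j\<in>I. of_bool (i \<noteq> j) :: real) = real (card (I - {i}))"
      using finI by (subst sum_of_bool_eq) (auto intro!: arg_cong[where f = card])
    also have "\<dots> = n - 1"
      using i finI n by (simp add: n_def of_nat_diff)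
    finally show "(\<Sum>j\<in>I. of_bool (i \<noteq> j) * (g True * g False)) = (n - 1) * (g True * g False)"
      unfolding sum_distrib_right[symmetric] by simp
  qed
  also have "\<dots> = n * (n - 1) * (g True * g False)" by (simp add: n_def)
  finally have key: "(\<Sum>c\<in>?\<Omega>. (\<Prod>i\<in>R. g (c i)) * (real (s c) * (n - real (s c))))
    = n * (n - 1) * (g True * g False)" .
  have "(\<Sum>c\<in>?\<Omega>. (\<Prod>i\<in>R. g (c i)) * (1 - real (s c) / n * (1 - real (s c) / n) / 2))
      = (\<Sum>c\<in>?\<Omega>. (\<Prod>i\<in>R. g (c i)) -
          (\<Prod>i\<in>R. g (c i)) * (real (s c) * (n - real (s c))) * (1 / (2 * n\<^sup>2)))"
    using n by (intro sum.cong refl) (simp add: field_simps power2_eq_square)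
  also have "\<dots> = 1 - n * (n - 1) * (g True * g False) * (1 / (2 * n\<^sup>2))"
    unfolding sum_subtractf sum_distrib_right[symmetric] key total ..
  also have "\<dots> = 1 - g True * g False * (1 - 1 / n) / 2"
    using n by (simp add: field_simps power2_eq_square)
  finally show ?thesis unfolding n_def .
qed

section \<open>The Tardos matrix as a family of independent columns\<close>

lemma finite_set_tardos_matrix_pmf: "finite (set_pmf (tardos_matrix_pmf N d p))"
  unfolding tardos_matrix_pmf_def
  by (rule finite_subset[OF set_Pi_pmf_subset']) (auto intro!: finite_PiE_dflt)

text \<open>The matrix is re-indexed column first, because \<open>sum_PiE_fibre_bound\<close> takes
  whole columns as its independent variables.\<close>

lemma expectation_tardos_matrix:
  fixes F :: "(nat \<times> nat \<Rightarrow> bool) \<Rightarrow> real"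
  shows "(\<integral>C. F C \<partial>measure_pmf (tardos_matrix_pmf N d p)) =
    (\<Sum>D\<in>{..<d} \<rightarrow>\<^sub>E ({..<N} \<rightarrow>\<^sub>E UNIV). (\<Prod>j<d. \<Prod>i<N. pmf (bernoulli_pmf (p j)) (D j i)) *
      F (\<lambda>(i, j). i < N \<and> j < d \<and> D j i))"
proof -
  let ?S = "PiE_dflt ({..<N} \<times> {..<d}) False (\<lambda>_. UNIV :: bool set)"
  have "(\<integral>C. F C \<partial>measure_pmf (tardos_matrix_pmf N d p))
      = (\<Sum>C\<in>?S. F C * pmf (tardos_matrix_pmf N d p) C)"
  proof (rule integral_measure_pmf_real)
    show "finite ?S" by (intro finite_PiE_dflt) auto
    fix C assume "C \<in> set_pmf (tardos_matrix_pmf N d p)"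
    then show "C \<in> ?S"
      unfolding tardos_matrix_pmf_def
      using set_Pi_pmf_subset'[of "{..<N} \<times> {..<d}" False "\<lambda>(i, j). bernoulli_pmf (p j)"]
      by (auto simp: PiE_dflt_def)
  qed
  also have "\<dots> = (\<Sum>C\<in>?S. (\<Prod>j<d. \<Prod>i<N. pmf (bernoulli_pmf (p j)) (C (i, j))) * F C)"
  proof (intro sum.cong refl)
    fix C assume "C \<in> ?S"
    then have "pmf (tardos_matrix_pmf N d p) C
        = (\<Prod>(i, j)\<in>{..<N} \<times> {..<d}. pmf (bernoulli_pmf (p j)) (C (i, j)))"
      unfolding tardos_matrix_pmf_def
      by (subst pmf_Pi') (auto simp: PiE_dflt_def case_prod_beta)
    also have "\<dots> = (\<Prod>j<d. \<Prod>i<N. pmf (bernoulli_pmf (p j)) (C (i, j)))"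
      by (subst prod.swap) (simp add: prod.cartesian_product)
    finally show "F C * pmf (tardos_matrix_pmf N d p) C
        = (\<Prod>j<d. \<Prod>i<N. pmf (bernoulli_pmf (p j)) (C (i, j))) * F C"
      by simp
  qed
  also have "\<dots> = (\<Sum>D\<in>{..<d} \<rightarrow>\<^sub>E ({..<N} \<rightarrow>\<^sub>E UNIV).
      (\<Prod>j<d. \<Prod>i<N. pmf (bernoulli_pmf (p j)) (D j i)) * F (\<lambda>(i, j). i < N \<and> j < d \<and> D j i))"
  \<comment> \<open>Two padding conventions are matched: matrices in \<open>?S\<close> are
    \<open>False\<close> outside the index range, whereas the nested \<open>PiE\<close> functions
    are \<open>undefined\<close> there.\<close>
  proof (rule sum.reindex_bij_witness[where j = "\<lambda>C. \<lambda>j\<in>{..<d}. \<lambda>i\<in>{..<N}. C (i, j)"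
        and i = "\<lambda>D (i, j). i < N \<and> j < d \<and> D j i"])
    fix C assume "C \<in> ?S"
    then show inv: "(\<lambda>(i, j). i < N \<and> j < d \<and> (\<lambda>j\<in>{..<d}. \<lambda>i\<in>{..<N}. C (i, j)) j i) = C"
      by (fastforce simp: PiE_dflt_def fun_eq_iff)
    show "(\<Prod>j<d. \<Prod>i<N. pmf (bernoulli_pmf (p j)) ((\<lambda>j\<in>{..<d}. \<lambda>i\<in>{..<N}. C (i, j)) j i)) *
        F (\<lambda>(i, j). i < N \<and> j < d \<and> (\<lambda>j\<in>{..<d}. \<lambda>i\<in>{..<N}. C (i, j)) j i)
      = (\<Prod>j<d. \<Prod>i<N. pmf (bernoulli_pmf (p j)) (C (i, j))) * F C"
      unfolding inv by simp
  next
    fix D :: "nat \<Rightarrow> nat \<Rightarrow> bool" assume D: "D \<in> {..<d} \<rightarrow>\<^sub>E ({..<N} \<rightarrow>\<^sub>E UNIV)"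
    show "(\<lambda>j\<in>{..<d}. \<lambda>i\<in>{..<N}. case (i, j) of (i, j) \<Rightarrow> i < N \<and> j < d \<and> D j i) = D"
    proof (rule PiE_ext[OF _ D])
      fix j assume j: "j \<in> {..<d}"
      then have "D j \<in> {..<N} \<rightarrow>\<^sub>E UNIV" using D by (rule PiE_mem[rotated])
      then show "(\<lambda>j\<in>{..<d}. \<lambda>i\<in>{..<N}. case (i, j) of (i, j) \<Rightarrow> i < N \<and> j < d \<and> D j i) j = D j"
        using j by (intro extensionalityI[of _ "{..<N}"]) (auto simp: PiE_iff)
    qed auto
  qed (auto simp: PiE_dflt_def)
  finally show ?thesis .
qed

lemma pmf_bernoulli_False: "pmf (bernoulli_pmf q) False = 1 - pmf (bernoulli_pmf q) True"
  by (simp add: pmf_bernoulli_clamp)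

text \<open>
  The product of \<open>bernoulli_pmf\<close> values is \<open>q (1 - q)\<close> on the unit interval; writing it this way
  keeps the later bounds valid for all real \<open>q\<close>, since \<open>bernoulli_pmf\<close> clamps its parameter.
\<close>

definition column_factor :: "nat \<Rightarrow> real \<Rightarrow> real" where
  "column_factor n q = 1 - pmf (bernoulli_pmf q) True * pmf (bernoulli_pmf q) False * (1 - 1 / real n) / 2"

text \<open>Once all column sums are fixed, so is the law of the guess, however it depends on them.
  Thus \<open>sum_PiE_fibre_bound\<close> applies, with \<open>fibre_guess_bound\<close> supplying
  the loss in each column, and \<open>column_expectation\<close> averages that loss over the column
  sum. The product over \<open>j\<close> is \<open>2^(-h)\<close> for the Hamming distance
  \<open>h\<close> between row \<open>r\<close> and \<open>z\<close>.\<close>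

lemma expectation_guess_row:
  fixes a :: "(nat \<Rightarrow> nat) \<Rightarrow> bool list \<Rightarrow> real"
  assumes I: "I \<subseteq> {..<N}" "r \<in> I"
    and a: "\<And>k z. 0 \<le> a k z" "\<And>k. (\<Sum>z | length z = d. a k z) \<le> 1"
  shows "(\<integral>C. (\<Sum>z | length z = d. a (\<lambda>j\<in>{..<d}. card {i\<in>I. C (i, j)}) z *
      (\<Prod>j<d. if C (r, j) = z ! j then 1 else 1 / 2)) \<partial>measure_pmf (tardos_matrix_pmf N d p))
    \<le> (\<Prod>j<d. column_factor (card I) (p j))"
proof -
  let ?\<Omega> = "{..<N} \<rightarrow>\<^sub>E (UNIV :: bool set)"
  let ?g = "\<lambda>j. pmf (bernoulli_pmf (p j))"
  let ?s = "\<lambda>c. card {i\<in>I. c i}"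
  let ?x = "\<lambda>k. real k / real (card I)"
  have finI: "finite I" using I finite_subset by blast
  have nn: "0 \<le> 1 - t * (1 - t) / 2" if "0 \<le> t" "t \<le> 1" for t :: real
  proof -
    have "t * (1 - t) \<le> 1" using that by (intro mult_le_one) auto
    then show ?thesis by simp
  qed
  have rN: "i < N" if "i \<in> I" for i using I that by auto
  have "(\<integral>C. (\<Sum>z | length z = d. a (\<lambda>j\<in>{..<d}. card {i\<in>I. C (i, j)}) z *
      (\<Prod>j<d. if C (r, j) = z ! j then 1 else 1 / 2)) \<partial>measure_pmf (tardos_matrix_pmf N d p))
    = (\<Sum>D\<in>{..<d} \<rightarrow>\<^sub>E ?\<Omega>. (\<Prod>j<d. \<Prod>i<N. ?g j (D j i)) *
        (\<Sum>z | length z = d. a (\<lambda>j\<in>{..<d}. ?s (D j)) z *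
          (\<Prod>j<d. if D j r = z ! j then 1 else 1 / 2)))"
    unfolding expectation_tardos_matrix
  proof (intro sum.cong refl arg_cong2[where f = "(*)"])
    fix D :: "nat \<Rightarrow> nat \<Rightarrow> bool" and z
    show "a (\<lambda>j\<in>{..<d}. card {i \<in> I. case (i, j) of (i, j) \<Rightarrow> i < N \<and> j < d \<and> D j i}) z
      = a (\<lambda>j\<in>{..<d}. ?s (D j)) z"
      using rN by (intro arg_cong2[where f = a] refl restrict_ext arg_cong[where f = card]) auto
  qed (use rN[OF I(2)] in auto)
  also have "\<dots> \<le> (\<Prod>j<d. \<Sum>c\<in>?\<Omega>. (\<Prod>i<N. ?g j (c i)) * (1 - ?x (?s c) * (1 - ?x (?s c)) / 2))"
  proof (rule sum_PiE_fibre_bound[where s = ?s and v = "\<lambda>k. 1 - ?x k * (1 - ?x k) / 2"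
        and w = "\<lambda>j c. \<Prod>i<N. ?g j (c i)"
        and u = "\<lambda>z j c. if c r = z ! j then 1 else 1 / 2"])
    show "finite ?\<Omega>" by (intro finite_PiE) auto
    fix k assume "k \<in> ?s ` ?\<Omega>"
    then have "k \<le> card I" using finI by (auto intro!: card_mono)
    then have "0 \<le> ?x k" "?x k \<le> 1" by (auto simp: divide_le_eq)
    then show "0 \<le> 1 - ?x k * (1 - ?x k) / 2" by (rule nn)
  next
    fix z :: "bool list" and j k
    show "(\<Sum>c | c \<in> ?\<Omega> \<and> ?s c = k. (\<Prod>i<N. ?g j (c i)) * (if c r = z ! j then 1 else 1 / 2))
      \<le> (1 - ?x k * (1 - ?x k) / 2) * (\<Sum>c | c \<in> ?\<Omega> \<and> ?s c = k. \<Prod>i<N. ?g j (c i))"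
      by (rule fibre_guess_bound) (use I in auto)
  qed (use a in \<open>auto intro!: prod_nonneg\<close>)
  also have "\<dots> = (\<Prod>j<d. column_factor (card I) (p j))"
    unfolding column_factor_def using I
    by (intro prod.cong refl column_expectation) (auto simp: pmf_bernoulli_False)
  finally show ?thesis .
qed

section \<open>Hamming distance and the union bound over sampled rows\<close>

lemma hamming_dist_matrix_row:
  assumes "length z = d"
  shows "hamming_dist (matrix_row d C r) z = card {j. j < d \<and> C (r, j) \<noteq> z ! j}"
  unfolding hamming_dist_def matrix_row_def using assms
  by (intro arg_cong[where f = card]) auto

text \<open>This is the exponential Markov step: the product is \<open>2^(-h)\<close> with
  \<open>h \<le> \<gamma> * d\<close>. Base 2 is traded for the larger base \<open>exp 1\<close>,
  which keeps the later estimate free of \<open>ln 2\<close> at the price of a weaker bound.\<close>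

lemma exp_hamming_ge_1:
  assumes "length z = d" "real (hamming_dist (matrix_row d C r) z) \<le> \<gamma> * real d"
  shows "1 \<le> exp (\<gamma> * real d) * (\<Prod>j<d. if C (r, j) = z ! j then 1 else 1 / 2 :: real)"
proof -
  define h where "h = hamming_dist (matrix_row d C r) z"
  have "(\<Prod>j<d. if C (r, j) = z ! j then 1 else 1 / 2 :: real) = (1 / 2) ^ h"
    unfolding h_def hamming_dist_matrix_row[OF assms(1)]
    by (simp add: prod.If_cases Int_def)
  moreover have "(2 :: real) ^ h \<le> exp (\<gamma> * real d)"
  proof -
    have "(2 :: real) ^ h \<le> exp 1 ^ h"
      using exp_ge_add_one_self[of 1] by (intro power_mono) auto
    also have "\<dots> = exp (real h)" by (simp add: exp_of_nat_mult[symmetric])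
    also have "\<dots> \<le> exp (\<gamma> * real d)" using assms(2) by (simp add: h_def)
    finally show ?thesis .
  qed
  ultimately show ?thesis by (simp only: power_divide power_one) (simp add: field_simps)
qed

text \<open>The output depends on the matrix only through the column sums, which makes the attacker
  fit \<open>expectation_guess_row\<close>; the restricted function is the argument that
  \<open>a\<close> receives there. Distinct indices turn the list sum into a cardinality.\<close>

lemma average_matrix_rows:
  assumes "distinct xs"
  shows "average d (map (matrix_row d C) xs) =
    map (\<lambda>j. real ((\<lambda>j\<in>{..<d}. card {i\<in>set xs. C (i, j)}) j) / real (length xs)) [0..<d]"
  unfolding average_def
proof (intro map_cong refl)
  fix j assume "j \<in> set [0..<d]"
  then have j: "j < d" by simp
  have "(\<Sum>x\<leftarrow>map (matrix_row d C) xs. of_bool (x ! j)) = (\<Sum>i\<leftarrow>xs. of_bool (C (i, j)) :: real)"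
    using j by (simp add: o_def matrix_row_def)
  also have "\<dots> = real (card {i\<in>set xs. C (i, j)})"
    using assms by (simp add: sum_list_distinct_conv_sum_set Int_def)
  finally show "(\<Sum>x\<leftarrow>map (matrix_row d C) xs. of_bool (x ! j)) / real (length (map (matrix_row d C) xs))
    = real ((\<lambda>j\<in>{..<d}. card {i\<in>set xs. C (i, j)}) j) / real (length xs)"
    using j by simp
qed

text \<open>A successful guess is close to at least one of the \<open>n\<close> sampled rows, so the
  success indicator is at most the sum of their scaled scores from \<open>exp_hamming_ge_1\<close>.
  \<open>expectation_guess_row\<close> bounds each expected score, whence the factor
  \<open>n\<close>.\<close>

lemma extraction_given_rows:
  assumes xs: "distinct xs" "length xs = n" "set xs \<subseteq> {..<N}"
    and A: "A \<in> count_space UNIV \<rightarrow>\<^sub>M prob_algebra (count_space UNIV)"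
  shows "(\<integral>\<^sup>+C. emeasure (A (average d (map (matrix_row d C) xs)))
        {z. hamming_relation d \<gamma> (map (matrix_row d C) xs) z} \<partial>measure_pmf (tardos_matrix_pmf N d p))
    \<le> ennreal (real n * exp (\<gamma> * real d) * (\<Prod>j<d. column_factor n (p j)))"
proof -
  \<comment> \<open>Only strings of length \<open>d\<close> can succeed. There are finitely many, so
    the attacker's law enters only through its point masses \<open>a k z\<close>.\<close>
  define Z where "Z = {z :: bool list. length z = d}"
  have finZ: "finite Z"
    unfolding Z_def using finite_lists_length_eq[of "UNIV :: bool set" d] by simp
  define y where "y k = map (\<lambda>j. real (k j) / real n) [0..<d]" for k :: "nat \<Rightarrow> nat"
  define a where "a k z = measure (A (y k)) {z}" for k z
  define S where "S C = map (matrix_row d C) xs" for C :: "nat \<times> nat \<Rightarrow> bool"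
  define K where "K C = (\<lambda>j\<in>{..<d}. card {i\<in>set xs. C (i, j)})" for C :: "nat \<times> nat \<Rightarrow> bool"
  have card: "card (set xs) = n" using xs by (simp add: distinct_card)
  have prob: "prob_space (A v)" "sets (A v) = UNIV" for v
    using measurable_space[OF A, of v] by (auto simp: space_prob_algebra)
  have singles: "measure (A v) X = (\<Sum>z\<in>X. measure (A v) {z})" if "finite X" for v X
  proof -
    interpret prob_space "A v" by (rule prob)
    show ?thesis using that by (intro finite_measure_eq_sum_singleton) (auto simp: prob)
  qed
  have avg: "average d (S C) = y (K C)" for C
    unfolding S_def K_def y_def average_matrix_rows[OF xs(1)] xs(2) ..
  let ?f = "\<lambda>C r. \<Sum>z\<in>Z. a (K C) z * (\<Prod>j<d. if C (r, j) = z ! j then 1 else 1 / 2)"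
  have point: "measure (A (average d (S C))) {z. hamming_relation d \<gamma> (S C) z}
      \<le> exp (\<gamma> * real d) * (\<Sum>r\<in>set xs. ?f C r)" for C
  proof -
    have "measure (A (average d (S C))) {z. hamming_relation d \<gamma> (S C) z}
        = (\<Sum>z | hamming_relation d \<gamma> (S C) z. a (K C) z)"
      unfolding avg a_def
      by (rule singles, rule finite_subset[OF _ finZ]) (auto simp: hamming_relation_def Z_def)
    also have "\<dots> = (\<Sum>z\<in>Z. a (K C) z * of_bool (hamming_relation d \<gamma> (S C) z))"
      using finZ by (intro sum.mono_neutral_cong_left) (auto simp: hamming_relation_def Z_def)
    also have "\<dots> \<le> (\<Sum>z\<in>Z. a (K C) z * (\<Sum>r\<in>set xs. exp (\<gamma> * real d) *
        (\<Prod>j<d. if C (r, j) = z ! j then 1 else 1 / 2)))"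
    proof (intro sum_mono mult_left_mono)
      fix z assume z: "z \<in> Z"
      let ?h = "\<lambda>r. exp (\<gamma> * real d) * (\<Prod>j<d. if C (r, j) = z ! j then 1 else 1 / 2 :: real)"
      have nn: "0 \<le> ?h r" for r by (intro mult_nonneg_nonneg prod_nonneg) auto
      show "of_bool (hamming_relation d \<gamma> (S C) z) \<le> (\<Sum>r\<in>set xs. ?h r)"
      proof (cases "hamming_relation d \<gamma> (S C) z")
        case True
        then obtain r where r: "r \<in> set xs"
          "real (hamming_dist (matrix_row d C r) z) \<le> \<gamma> * real d"
          by (auto simp: hamming_relation_def S_def)
        have "1 \<le> ?h r" using z r by (intro exp_hamming_ge_1) (auto simp: Z_def)
        also have "\<dots> \<le> (\<Sum>r\<in>set xs. ?h r)" using r nn by (intro member_le_sum) auto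
        finally show ?thesis using True by simp
      qed (use nn in \<open>auto intro!: sum_nonneg\<close>)
    qed (simp add: a_def)
    also have "\<dots> = exp (\<gamma> * real d) * (\<Sum>r\<in>set xs. ?f C r)"
      unfolding sum_distrib_left by (subst sum.swap) (simp add: mult_ac)
    finally show ?thesis .
  qed
  have nn: "0 \<le> ?f C r" for C r
    by (intro sum_nonneg mult_nonneg_nonneg prod_nonneg) (auto simp: a_def)
  have int: "integrable (measure_pmf (tardos_matrix_pmf N d p)) f" for f :: "_ \<Rightarrow> real"
    by (intro integrable_measure_pmf_finite finite_set_tardos_matrix_pmf)
  have "(\<integral>\<^sup>+C. emeasure (A (average d (S C))) {z. hamming_relation d \<gamma> (S C) z}
        \<partial>measure_pmf (tardos_matrix_pmf N d p))
      \<le> (\<integral>\<^sup>+C. ennreal (exp (\<gamma> * real d) * (\<Sum>r\<in>set xs. ?f C r)) \<partial>measure_pmf (tardos_matrix_pmf N d p))"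
    using point prob_space.finite_measure[OF prob(1)]
    by (intro nn_integral_mono) (simp add: finite_measure.emeasure_eq_measure ennreal_leI)
  also have "\<dots> = ennreal (\<integral>C. exp (\<gamma> * real d) * (\<Sum>r\<in>set xs. ?f C r) \<partial>measure_pmf (tardos_matrix_pmf N d p))"
    by (intro nn_integral_eq_integral int AE_I2 mult_nonneg_nonneg sum_nonneg[OF nn]) simp
  also have "\<dots> = ennreal (exp (\<gamma> * real d) *
      (\<Sum>r\<in>set xs. \<integral>C. ?f C r \<partial>measure_pmf (tardos_matrix_pmf N d p)))"
    by (subst integral_mult_right_zero, subst Bochner_Integration.integral_sum) (auto intro: int)
  also have "\<dots> \<le> ennreal (exp (\<gamma> * real d) * (\<Sum>r\<in>set xs. \<Prod>j<d. column_factor n (p j)))"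
  proof (intro ennreal_leI mult_left_mono sum_mono)
    fix r assume r: "r \<in> set xs"
    show "(\<integral>C. ?f C r \<partial>measure_pmf (tardos_matrix_pmf N d p)) \<le> (\<Prod>j<d. column_factor n (p j))"
      unfolding K_def Z_def card[symmetric]
    proof (rule expectation_guess_row[OF xs(3) r])
      fix k
      have "(\<Sum>z | length z = d. a k z) = measure (A (y k)) Z"
        unfolding a_def Z_def[symmetric] by (rule singles[OF finZ, symmetric])
      also have "\<dots> \<le> 1" by (rule prob_space.prob_le_1[OF prob(1)])
      finally show "(\<Sum>z | length z = d. a k z) \<le> 1" .
    qed (simp add: a_def)
  qed auto
  also have "\<dots> = ennreal (real n * exp (\<gamma> * real d) * (\<Prod>j<d. column_factor n (p j)))"
    by (simp add: card mult_ac)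
  finally show ?thesis unfolding S_def .
qed

section \<open>Averaging over the column biases\<close>

lemma column_factor_eq:
  "0 \<le> q \<Longrightarrow> q \<le> 1 \<Longrightarrow> column_factor n q = 1 - q * (1 - q) * (1 - 1 / real n) / 2"
  unfolding column_factor_def by simp

lemma column_factor_nonneg:
  assumes "0 < n"
  shows "0 \<le> column_factor n q"
proof -
  have "pmf (bernoulli_pmf q) True * pmf (bernoulli_pmf q) False * (1 - 1 / real n) \<le> 1 * 1 * 1"
    using assms by (intro mult_mono mult_nonneg_nonneg pmf_le_1) (auto simp: divide_le_eq)
  then show ?thesis unfolding column_factor_def by simp
qed

lemma measurable_column_factor [measurable]: "column_factor n \<in> borel_measurable borel"
  unfolding column_factor_def
  by (intro borel_measurable_diff borel_measurable_divide borel_measurable_times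
      measurable_pmf_bernoulli borel_measurable_const)

text \<open>The constant 12 arises because \<open>q * (1 - q)\<close> integrates to
  \<open>1/2 - 1/3 = 1/6\<close> over the unit interval and is halved in
  \<open>column_factor\<close>.\<close>

lemma nn_integral_column_factor:
  assumes "0 < n"
  shows "(\<integral>\<^sup>+q. ennreal (column_factor n q) \<partial>uniform_measure lborel {0..1})
    = ennreal (1 - (1 - 1 / real n) / 12)"
proof -
  let ?e = "1 - 1 / real n"
  have "(\<integral>\<^sup>+q. ennreal (column_factor n q) \<partial>uniform_measure lborel {0..1})
      = (\<integral>\<^sup>+q. ennreal (column_factor n q) * indicator {0..1} q \<partial>lborel)"
    by (subst nn_integral_uniform_measure) (auto simp: divide_ennreal_def)
  also have "\<dots> = ennreal ((1 - (1 / 2 - 1 / 3) * ?e / 2) - 0)"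
  proof (subst nn_integral_FTC_Icc[where F = "\<lambda>q. q - (q ^ 2 / 2 - q ^ 3 / 3) * ?e / 2"])
    fix q :: real assume q: "q \<in> {0..1}"
    have "((\<lambda>q. q - (q ^ 2 / 2 - q ^ 3 / 3) * ?e / 2) has_real_derivative 1 - (q - q ^ 2) * ?e / 2) (at q)"
      by (auto intro!: derivative_eq_intros)
    then show "((\<lambda>q. q - (q ^ 2 / 2 - q ^ 3 / 3) * ?e / 2) has_real_derivative column_factor n q) (at q)"
      using q by (simp add: column_factor_eq power2_eq_square algebra_simps)
    show "0 \<le> column_factor n q" by (rule column_factor_nonneg[OF assms])
  qed auto
  also have "\<dots> = ennreal (1 - ?e / 12)" by simp
  finally show ?thesis .
qed

lemma nn_integral_prod_column_factor:
  assumes "0 < n"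
  shows "(\<integral>\<^sup>+p. ennreal (\<Prod>j<d. column_factor n (p j)) \<partial>(\<Pi>\<^sub>M j\<in>{..<d}. uniform_measure lborel {0..1}))
    = ennreal ((1 - (1 - 1 / real n) / 12) ^ d)"
proof -
  interpret prob_space "uniform_measure lborel {0..1::real}"
    by (intro prob_space_uniform_measure) auto
  interpret product_sigma_finite "\<lambda>_ :: nat. uniform_measure lborel {0..1::real}"
    by unfold_locales
  have "(\<integral>\<^sup>+p. ennreal (\<Prod>j<d. column_factor n (p j)) \<partial>(\<Pi>\<^sub>M j\<in>{..<d}. uniform_measure lborel {0..1}))
      = (\<integral>\<^sup>+p. (\<Prod>j<d. ennreal (column_factor n (p j))) \<partial>(\<Pi>\<^sub>M j\<in>{..<d}. uniform_measure lborel {0..1}))"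
    by (simp add: prod_ennreal column_factor_nonneg[OF assms])
  also have "\<dots> = (\<Prod>j<d. \<integral>\<^sup>+q. ennreal (column_factor n q) \<partial>uniform_measure lborel {0..1})"
    by (rule product_nn_integral_prod) (auto cong: measurable_cong_sets)
  also have "\<dots> = ennreal ((1 - (1 - 1 / real n) / 12) ^ d)"
    using assms unfolding nn_integral_column_factor[OF assms]
    by (simp add: ennreal_power field_simps)
  finally show ?thesis .
qed

section \<open>The extraction game under the Tardos prior\<close>

text \<open>The Giry-monad binds unfold into iterated integrals, and the deterministic mechanism
  collapses by \<open>bind_return\<close>, which feeds \<open>f S\<close> directly to the
  attacker.\<close>

lemma emeasure_extraction_game:
  fixes R :: "'x dataset \<Rightarrow> bool list \<Rightarrow> bool" and f :: "'x dataset \<Rightarrow> 'y"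
  assumes Prior: "Prior \<in> space (prob_algebra (prob_algebra (count_space UNIV)))"
    and A: "A \<in> count_space UNIV \<rightarrow>\<^sub>M prob_algebra (count_space UNIV)"
  shows "emeasure (extraction_game Prior R (\<lambda>S. return (count_space UNIV) (f S)) A) {True}
    = (\<integral>\<^sup>+Nature. \<integral>\<^sup>+S. emeasure (A (f S)) {z. R S z} \<partial>Nature \<partial>Prior)"
proof -
  define H where "H S = return (count_space UNIV) (f S) \<bind>
    (\<lambda>y. A y \<bind> (\<lambda>z. return (count_space UNIV) (R S z)))" for S
  have ret: "(\<lambda>z. return (count_space UNIV) (R S z)) \<in> count_space UNIV \<rightarrow>\<^sub>M prob_algebra (count_space UNIV)"
    for S by (auto simp: space_prob_algebra intro!: prob_space_return)
  have AR: "(\<lambda>y. A y \<bind> (\<lambda>z. return (count_space UNIV) (R S z)))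
      \<in> count_space UNIV \<rightarrow>\<^sub>M prob_algebra (count_space UNIV)" for S
    by (rule measurable_bind_prob_space[OF A ret])
  have H: "H S = A (f S) \<bind> (\<lambda>z. return (count_space UNIV) (R S z))" for S
    unfolding H_def by (rule bind_return[OF measurable_prob_algebraD[OF AR]]) simp
  have "H S \<in> space (prob_algebra (count_space UNIV))" for S
    unfolding H using measurable_space[OF AR] by simp
  then have Hm: "H \<in> count_space UNIV \<rightarrow>\<^sub>M prob_algebra (count_space UNIV)"
    by simp
  have eH: "emeasure (H S) {True} = emeasure (A (f S)) {z. R S z}" for S
  proof -
    have Af: "A (f S) \<in> space (prob_algebra (count_space UNIV))"
      using measurable_space[OF A] by simp
    have "emeasure (H S) {True} = (\<integral>\<^sup>+z. emeasure (return (count_space UNIV) (R S z)) {True} \<partial>A (f S))"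
      unfolding H by (rule emeasure_bind_prob_algebra[OF Af ret]) simp
    also have "\<dots> = (\<integral>\<^sup>+z. indicator {z. R S z} z \<partial>A (f S))"
      by (intro nn_integral_cong) (simp add: indicator_def)
    also have "\<dots> = emeasure (A (f S)) {z. R S z}"
      using Af by (intro nn_integral_indicator) (auto simp: space_prob_algebra)
    finally show ?thesis .
  qed
  have NH: "(\<lambda>Nature. Nature \<bind> H) \<in> prob_algebra (count_space UNIV) \<rightarrow>\<^sub>M prob_algebra (count_space UNIV)"
    by (rule measurable_bind_prob_space[OF _ Hm]) simp
  have "emeasure (Prior \<bind> (\<lambda>Nature. Nature \<bind> H)) {True}
      = (\<integral>\<^sup>+Nature. emeasure (Nature \<bind> H) {True} \<partial>Prior)"
    by (rule emeasure_bind_prob_algebra[OF Prior NH]) simp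
  also have "\<dots> = (\<integral>\<^sup>+Nature. \<integral>\<^sup>+S. emeasure (H S) {True} \<partial>Nature \<partial>Prior)"
  proof (rule nn_integral_cong)
    \<comment> \<open>The bind rule needs \<open>Nature\<close> in the space of distributions;
      integration only provides \<open>space Prior\<close>, which agrees with it through the
      sigma-algebra of \<open>Prior\<close>.\<close>
    fix Nature assume "Nature \<in> space Prior"
    also have "space Prior = space (prob_algebra (count_space UNIV))"
      using Prior by (auto simp: space_prob_algebra dest: sets_eq_imp_space_eq)
    finally show "emeasure (Nature \<bind> H) {True} = (\<integral>\<^sup>+S. emeasure (H S) {True} \<partial>Nature)"
      by (rule emeasure_bind_prob_algebra[OF _ Hm]) simp
  qed
  finally show ?thesis
    unfolding eH unfolding H_def extraction_game_def .
qed

lemma nn_integral_tardos: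
  assumes "g \<in> borel_measurable (prob_algebra (count_space UNIV))"
  shows "(\<integral>\<^sup>+Nature. g Nature \<partial>tardos N d n) =
    (\<integral>\<^sup>+p. \<integral>\<^sup>+C. g (measure_pmf (sample_rows_pmf N d n C)) \<partial>measure_pmf (tardos_matrix_pmf N d p)
      \<partial>(\<Pi>\<^sub>M j\<in>{..<d}. uniform_measure lborel {0..1}))"
proof -
  let ?row = "\<lambda>C. return (prob_algebra (count_space UNIV)) (measure_pmf (sample_rows_pmf N d n C))"
  have mem: "measure_pmf q \<in> space (prob_algebra (count_space UNIV))" for q :: "'b pmf"
    by (auto simp: space_prob_algebra prob_space_measure_pmf)
  have row: "?row \<in> count_space UNIV \<rightarrow>\<^sub>M prob_algebra (prob_algebra (count_space UNIV))"
    by (auto simp: space_prob_algebra prob_space_measure_pmf intro!: prob_space_return)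
  have row': "?row \<in> measure_pmf q \<rightarrow>\<^sub>M subprob_algebra (prob_algebra (count_space UNIV))" for q
    using measurable_prob_algebraD[OF row] by simp
  show ?thesis
    unfolding tardos_def
    by (subst nn_integral_bind[OF assms measurable_prob_algebraD[OF
            measurable_bind_prob_space[OF measurable_tardos_matrix_pmf row]]],
        subst nn_integral_bind[OF assms row'], subst nn_integral_return[OF mem assms], rule refl)
qed

text \<open>The row indices are drawn independently of the matrix, so the two averages can be
  exchanged, and a bound that is uniform in the indices survives. Integrating over the independent
  biases then gives a \<open>d\<close>-th power.\<close>

lemma tardos_extraction_bound:
  assumes n: "0 < n" "n \<le> N"
    and A: "A \<in> count_space UNIV \<rightarrow>\<^sub>M prob_algebra (count_space UNIV)"
  shows "measure (extraction_game (tardos N d n) (hamming_relation d \<gamma>) (average_mechanism d) A) {True}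
    \<le> real n * exp (\<gamma> * real d) * (1 - (1 - 1 / real n) / 12) ^ d"
proof -
  define G where "G S = emeasure (A (average d S)) {z. hamming_relation d \<gamma> S z}" for S
  let ?P = "\<Pi>\<^sub>M j\<in>{..<d}. uniform_measure lborel {0..1::real}"
  let ?X = "{xs :: nat list. length xs = n \<and> distinct xs \<and> set xs \<subseteq> {..<N}}"
  let ?b = "\<lambda>p. real n * exp (\<gamma> * real d) * (\<Prod>j<d. column_factor n (p j))"
  have finX: "finite ?X"
    by (rule finite_subset[OF _ finite_lists_length_eq[of "{..<N}" n]]) auto
  \<comment> \<open>This is where \<open>n \<le> N\<close> matters: \<open>pmf_of_set\<close> is the
    uniform law only on a nonempty finite set.\<close>
  have "[0..<n] \<in> ?X" using n by auto
  then have neX: "?X \<noteq> {}" by blast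
  have mG: "(\<lambda>Nature. \<integral>\<^sup>+S. G S \<partial>Nature) \<in> borel_measurable (prob_algebra (count_space UNIV))"
    unfolding prob_algebra_def
    by (intro measurable_restrict_space1 nn_integral_measurable_subprob_algebra) simp
  have rows: "(\<integral>\<^sup>+C. \<integral>\<^sup>+S. G S \<partial>measure_pmf (sample_rows_pmf N d n C) \<partial>measure_pmf (tardos_matrix_pmf N d p))
      \<le> ennreal (?b p)" for p
  proof -
    have "(\<integral>\<^sup>+C. \<integral>\<^sup>+S. G S \<partial>measure_pmf (sample_rows_pmf N d n C) \<partial>measure_pmf (tardos_matrix_pmf N d p))
      = (\<integral>\<^sup>+C. (\<Sum>xs\<in>?X. G (map (matrix_row d C) xs)) / of_nat (card ?X) \<partial>measure_pmf (tardos_matrix_pmf N d p))"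
      unfolding sample_rows_pmf_def
      by (simp add: nn_integral_pmf_of_set[OF neX finX])
    also have "\<dots> = (\<Sum>xs\<in>?X. \<integral>\<^sup>+C. G (map (matrix_row d C) xs) \<partial>measure_pmf (tardos_matrix_pmf N d p))
        / of_nat (card ?X)"
      by (subst nn_integral_divide, simp, subst nn_integral_sum) auto
    also have "\<dots> \<le> (\<Sum>xs\<in>?X. ennreal (?b p)) / of_nat (card ?X)"
      unfolding G_def
      by (intro divide_right_mono_ennreal sum_mono extraction_given_rows A) auto
    also have "\<dots> = ennreal (?b p)"
      using neX finX by (simp add: ennreal_of_nat_eq_real_of_nat ennreal_mult[symmetric]
          divide_ennreal card_gt_0_iff prod_nonneg column_factor_nonneg[OF n(1)])
    finally show ?thesis .
  qed
  have nonneg: "0 \<le> 1 - (1 - 1 / real n) / 12" using n by (simp add: field_simps)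
  have "emeasure (extraction_game (tardos N d n) (hamming_relation d \<gamma>) (average_mechanism d) A) {True}
      = (\<integral>\<^sup>+Nature. \<integral>\<^sup>+S. G S \<partial>Nature \<partial>tardos N d n)"
    unfolding G_def average_mechanism_def[abs_def]
    by (rule emeasure_extraction_game[OF tardos_in_space A])
  also have "\<dots> \<le> (\<integral>\<^sup>+p. ennreal (?b p) \<partial>?P)"
    unfolding nn_integral_tardos[OF mG] by (intro nn_integral_mono rows)
  also have "\<dots> = (\<integral>\<^sup>+p. ennreal (real n * exp (\<gamma> * real d)) * ennreal (\<Prod>j<d. column_factor n (p j)) \<partial>?P)"
    by (simp add: ennreal_mult prod_nonneg column_factor_nonneg[OF n(1)])
  also have "\<dots> = ennreal (real n * exp (\<gamma> * real d)) * (\<integral>\<^sup>+p. ennreal (\<Prod>j<d. column_factor n (p j)) \<partial>?P)"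
  proof (rule nn_integral_cmult)
    have "(\<lambda>p. p j) \<in> ?P \<rightarrow>\<^sub>M borel" if "j < d" for j
      using measurable_component_singleton[of j "{..<d}" "\<lambda>_. uniform_measure lborel {0..1::real}"] that
      by (simp cong: measurable_cong_sets)
    then show "(\<lambda>p. ennreal (\<Prod>j<d. column_factor n (p j))) \<in> borel_measurable ?P"
      by (intro measurable_compose[OF _ measurable_ennreal] borel_measurable_prod
          measurable_compose[OF _ measurable_column_factor]) auto
  qed
  also have "\<dots> = ennreal (real n * exp (\<gamma> * real d) * (1 - (1 - 1 / real n) / 12) ^ d)"
    unfolding nn_integral_prod_column_factor[OF n(1)]
    using nonneg by (simp add: ennreal_mult)
  finally show ?thesis
    unfolding measure_def using nonneg by (intro enn2real_leI) auto
qed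

section \<open>Choice of constants\<close>

text \<open>For \<open>n \<ge> 100\<close> the gain per column is at least
  \<open>(99/100) / 12 = 33/400\<close>, while the Hamming tolerance costs at most
  \<open>1/25 = 16/400\<close>. The surplus \<open>17/400\<close> exceeds \<open>1/100\<close>, so
  \<open>d \<ge> 100 * ln (n / \<delta>)\<close> pushes the exponentials below
  \<open>\<delta> / n\<close>, which absorbs the union bound factor \<open>n\<close>.\<close>

lemma union_bound_le:
  fixes \<delta> \<gamma> :: real
  assumes "0 < \<delta>" "100 \<le> real n" "100 * ln (real n / \<delta>) \<le> real d" "\<gamma> \<le> 1 / 25"
  shows "real n * exp (\<gamma> * real d) * (1 - (1 - 1 / real n) / 12) ^ d \<le> \<delta>"
proof -
  have "1 / real n \<le> 1 / 100" using assms(2) by (intro divide_left_mono) auto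
  then have "1 - (1 - 1 / real n) / 12 \<le> 1 + (- 33 / 400)" by (simp only: field_simps) simp
  also have "\<dots> \<le> exp (- 33 / 400)" by (rule exp_ge_add_one_self)
  finally have "(1 - (1 - 1 / real n) / 12) ^ d \<le> exp (- 33 / 400) ^ d"
    using assms(2) by (intro power_mono) (auto simp: field_simps)
  also have "\<dots> = exp (- 33 / 400 * real d)" by (simp add: exp_of_nat_mult[symmetric] mult.commute)
  finally have pow: "(1 - (1 - 1 / real n) / 12) ^ d \<le> exp (- 33 / 400 * real d)" .
  have "\<gamma> * real d \<le> 1 / 25 * real d" using assms(4) by (rule mult_right_mono) simp
  then have "\<gamma> * real d + - 33 / 400 * real d \<le> - ln (real n / \<delta>)" using assms(3) by linarith
  then have "exp (\<gamma> * real d) * exp (- 33 / 400 * real d) \<le> exp (- ln (real n / \<delta>))"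
    by (simp add: exp_add[symmetric])
  also have "\<dots> = \<delta> / real n" using assms(1,2) by (simp add: exp_minus)
  finally have "exp (\<gamma> * real d) * exp (- 33 / 400 * real d) \<le> \<delta> / real n" .
  moreover have "exp (\<gamma> * real d) * (1 - (1 - 1 / real n) / 12) ^ d
      \<le> exp (\<gamma> * real d) * exp (- 33 / 400 * real d)"
    using pow by (rule mult_left_mono) simp
  ultimately have "exp (\<gamma> * real d) * (1 - (1 - 1 / real n) / 12) ^ d \<le> \<delta> / real n" by linarith
  then have "real n * (exp (\<gamma> * real d) * (1 - (1 - 1 / real n) / 12) ^ d) \<le> real n * (\<delta> / real n)"
    by (rule mult_left_mono) simp
  then show ?thesis using assms(2) by (simp add: mult_ac)
qed

theorem lemma3p5:
  shows "\<exists>c::real. c > 0 \<and>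
    (\<forall>(\<delta>::real) (N::nat) (n::nat) (d::nat) (\<gamma>::real) (\<epsilon>::real).
       0 < \<delta> \<longrightarrow> \<delta> < 1 \<longrightarrow>
       0 < N \<longrightarrow> 0 < n \<longrightarrow> 0 < d \<longrightarrow>
       n \<le> N \<longrightarrow> c \<le> real n \<longrightarrow> c * ln (real n / \<delta>) \<le> real d \<longrightarrow>
       0 \<le> \<gamma> \<longrightarrow> \<gamma> \<le> 1 / 25 \<longrightarrow>
       0 \<le> \<epsilon> \<longrightarrow>
       bayesian_extraction_safe (count_space UNIV) (count_space UNIV) \<epsilon> \<delta>
         (tardos N d n) (hamming_relation d \<gamma>) (average_mechanism d))"
proof (intro exI[of _ 100] conjI allI impI)
  fix \<delta> \<gamma> \<epsilon> :: real and N n d :: nat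
  assume *: "0 < \<delta>" "0 < n" "n \<le> N" "100 \<le> real n" "100 * ln (real n / \<delta>) \<le> real d" "\<gamma> \<le> 1 / 25"
  show "bayesian_extraction_safe (count_space UNIV) (count_space UNIV) \<epsilon> \<delta>
      (tardos N d n) (hamming_relation d \<gamma>) (average_mechanism d)"
    unfolding bayesian_extraction_safe_def
  proof (intro conjI ballI tardos_in_space)
    show "average_mechanism d \<in> count_space UNIV \<rightarrow>\<^sub>M prob_algebra (count_space UNIV)"
      by (auto simp: average_mechanism_def space_prob_algebra intro!: prob_space_return)
    \<comment> \<open>Datasets and strings form countable types, so the product sigma-algebra is
      again discrete.\<close>
    show "Measurable.pred (count_space UNIV \<Otimes>\<^sub>M count_space UNIV) (\<lambda>(S, z). hamming_relation d \<gamma> S z)"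
      by (subst pair_measure_countable) auto
    fix A :: "real list \<Rightarrow> bool list measure"
    assume "A \<in> count_space UNIV \<rightarrow>\<^sub>M prob_algebra (count_space UNIV)"
    then have "measure (extraction_game (tardos N d n) (hamming_relation d \<gamma>) (average_mechanism d) A) {True} \<le> \<delta>"
      using tardos_extraction_bound[of n N A d \<gamma>] union_bound_le[of \<delta> n d \<gamma>] * by linarith
    then show "measure (extraction_game (tardos N d n) (hamming_relation d \<gamma>) (average_mechanism d) A) {True}
      \<le> exp \<epsilon> * measure (fresh_extraction_game (tardos N d n) (hamming_relation d \<gamma>) (average_mechanism d) A) {True} + \<delta>"
      by (simp add: add_increasing)
  qed
qed simp

end
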